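(* Let $G$ be a marked group and let $T_G$ be its centralizer tree. Then $T_G$ is well-founded if and only if $G$ satisfies the minimal condition on centralizers.
   Context: Let $\mathbb{F}_\omega$ be the free group on countably many letters, with a fixed enumeration $(\gamma_i)_{i\in\mathbb{N}}$ of its elements. A marked group is $G=\mathbb{F}_\omega/N$ with $N\trianglelefteq\mathbb{F}_\omega$; it carries the enumeration $g_i:=\gamma_iN$, $i\in\mathbb{N}$ (repetitions allowed). For $s=(s_0,\dots,s_n)\in\mathbb{N}^{<\mathbb{N}}$ write $\{g_s\}=\{g_{s_0},\dots,g_{s_n}\}$, with $\{g_\emptyset\}=\emptyset$. A subgroup $H\le G$ is a centralizer in $G$ if $H=C_G(A)$ for some $A\subseteq G$. $G$ satisfies the minimal condition on centralizers if there is no infinite strictly decreasing chain $C_0>C_1>\cdots$ of centralizers in $G$. The centralizer tree $T_G\subseteq\mathbb{N}^{<\mathbb{N}}$ is defined recursively, writing $(s,i)$ for the sequence $s$ extended by the term $i$: $\emptyset\in T_G$; and if $s\in T_G$ and $i\in\mathbb{N}$, then $(s,i)\in T_G$ if and only if $C_G(\{g_s\}\cup\{g_i\})\ne C_G(\{g_s\})$ (where $C_G(\emptyset)=G$). A tree $T\subseteq\mathbb{N}^{<\mathbb{N}}$ (a set of finite sequences closed under initial segments) is well-founded if there is no $x\in\mathbb{N}^{\mathbb{N}}$ all of whose finite initial segments lie in $T$. *)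

theory Defs
  imports "HOL-Algebra.Coset" "HOL-Library.Sublist"
begin

section \<open>Free groups\<close>

text \<open>
  The free group on the type \<open>'a\<close> as the group of reduced words: the letter \<open>(a, True)\<close> stands
  for the generator \<open>a\<close>, the letter \<open>(a, False)\<close> for its formal inverse.
\<close>

type_synonym 'a word = "('a \<times> bool) list"

fun inv_letter :: "'a \<times> bool \<Rightarrow> 'a \<times> bool" where
  "inv_letter (a, b) = (a, \<not> b)"

definition reduced :: "'a word \<Rightarrow> bool" where
  "reduced w \<longleftrightarrow> successively (\<lambda>x y. y \<noteq> inv_letter x) w"

text \<open>Multiplication of a reduced word by a single letter from the left.\<close>

definition cons_red :: "'a \<times> bool \<Rightarrow> 'a word \<Rightarrow> 'a word" where
  "cons_red x w = (if w \<noteq> [] \<and> hd w = inv_letter x then tl w else x # w)"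

definition free_group :: "'a word monoid" where
  "free_group = \<lparr>carrier = {w. reduced w}, mult = (\<lambda>u v. foldr cons_red u v), one = []\<rparr>"

lemma inv_letter_inv_letter [simp]: "inv_letter (inv_letter x) = x"
  by (cases x) simp

lemma inv_letter_neq [simp]: "inv_letter x \<noteq> x"
  by (cases x) simp

lemma reduced_Nil [simp]: "reduced []"
  by (simp add: reduced_def)

lemma reduced_Cons: "reduced (x # w) \<longleftrightarrow> w = [] \<or> hd w \<noteq> inv_letter x \<and> reduced w"
  by (auto simp: reduced_def successively_Cons)

lemma reduced_cons_red: "reduced w \<Longrightarrow> reduced (cons_red x w)"
  by (cases w) (auto simp: cons_red_def reduced_Cons)

lemma reduced_foldr: "reduced v \<Longrightarrow> reduced (foldr cons_red u v)"
  by (induction u) (auto intro: reduced_cons_red)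

lemma cons_red_cancel: "reduced w \<Longrightarrow> cons_red x (cons_red (inv_letter x) w) = w"
  by (cases w; cases "tl w") (auto simp: cons_red_def reduced_Cons)

lemma cons_red_cancel': "reduced w \<Longrightarrow> cons_red (inv_letter x) (cons_red x w) = w"
  using cons_red_cancel[of w "inv_letter x"] by simp

lemma foldr_cons_red:
  assumes "reduced v"
  shows "foldr cons_red (cons_red x u) v = cons_red x (foldr cons_red u v)"
proof (cases "u \<noteq> [] \<and> hd u = inv_letter x")
  case True
  then obtain u' where "u = inv_letter x # u'"
    by (cases u) auto
  then show ?thesis
    using cons_red_cancel[OF reduced_foldr[OF assms]] by (simp add: cons_red_def[of x "_ # _"])
next
  case False
  then show ?thesis by (auto simp: cons_red_def[of x u])
qed

lemma foldr_foldr_cons_red: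
  assumes "reduced w"
  shows "foldr cons_red (foldr cons_red u v) w = foldr cons_red u (foldr cons_red v w)"
  by (induction u) (simp_all add: foldr_cons_red assms)

lemma foldr_rev_cancel:
  assumes "reduced w"
  shows "foldr cons_red (rev (map inv_letter u)) (foldr cons_red u w) = w"
  by (induction u) (simp_all add: cons_red_cancel' reduced_foldr assms)

lemma foldr_reduced_Nil: "reduced u \<Longrightarrow> foldr cons_red u [] = u"
  by (induction u) (auto simp: cons_red_def reduced_Cons)

lemma group_free_group: "group (free_group :: 'a word monoid)"
proof (rule groupI)
  fix u :: "'a word"
  assume "u \<in> carrier free_group"
  then have u: "reduced u" by (simp add: free_group_def)
  let ?v = "foldr cons_red (rev (map inv_letter u)) []"
  have "foldr cons_red ?v u = foldr cons_red (rev (map inv_letter u)) (foldr cons_red u [])"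
    using u by (simp add: foldr_foldr_cons_red foldr_reduced_Nil)
  also have "\<dots> = []" by (rule foldr_rev_cancel) simp
  finally show "\<exists>v\<in>carrier free_group. v \<otimes>\<^bsub>free_group\<^esub> u = \<one>\<^bsub>free_group\<^esub>"
    by (auto simp: free_group_def intro!: exI[of _ ?v] reduced_foldr)
qed (auto simp: free_group_def reduced_foldr foldr_foldr_cons_red)

abbreviation F_omega :: "nat word monoid" where
  "F_omega \<equiv> free_group"


section \<open>Centralizers\<close>

definition centralizer :: "('a, 'b) monoid_scheme \<Rightarrow> 'a set \<Rightarrow> 'a set" where
  "centralizer G A = {x \<in> carrier G. \<forall>a\<in>A. x \<otimes>\<^bsub>G\<^esub> a = a \<otimes>\<^bsub>G\<^esub> x}"

definition is_centralizer :: "('a, 'b) monoid_scheme \<Rightarrow> 'a set \<Rightarrow> bool" where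
  "is_centralizer G H \<longleftrightarrow> subgroup H G \<and> (\<exists>A. A \<subseteq> carrier G \<and> H = centralizer G A)"

definition min_condition_centralizers :: "('a, 'b) monoid_scheme \<Rightarrow> bool" where
  "min_condition_centralizers G \<longleftrightarrow>
     (\<nexists>C :: nat \<Rightarrow> 'a set. (\<forall>n. is_centralizer G (C n)) \<and> (\<forall>n. C (Suc n) \<subset> C n))"


section \<open>Trees of finite sequences\<close>

definition is_tree :: "nat list set \<Rightarrow> bool" where
  "is_tree T \<longleftrightarrow> (\<forall>s\<in>T. \<forall>t. prefix t s \<longrightarrow> t \<in> T)"

definition well_founded_tree :: "nat list set \<Rightarrow> bool" where
  "well_founded_tree T \<longleftrightarrow> is_tree T \<and> (\<nexists>x :: nat \<Rightarrow> nat. \<forall>n. map x [0..<n] \<in> T)"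

inductive_set centralizer_tree :: "('a, 'b) monoid_scheme \<Rightarrow> (nat \<Rightarrow> 'a) \<Rightarrow> nat list set"
  for G :: "('a, 'b) monoid_scheme" and g :: "nat \<Rightarrow> 'a" where
  Nil: "[] \<in> centralizer_tree G g"
| snoc: "s \<in> centralizer_tree G g \<Longrightarrow>
    centralizer G (g ` set s \<union> {g i}) \<noteq> centralizer G (g ` set s) \<Longrightarrow>
    s @ [i] \<in> centralizer_tree G g"

lemma snoc_in_centralizer_tree_iff:
  "s @ [i] \<in> centralizer_tree G g \<longleftrightarrow>
     s \<in> centralizer_tree G g \<and> centralizer G (g ` set s \<union> {g i}) \<noteq> centralizer G (g ` set s)"
  by (auto elim: centralizer_tree.cases intro: centralizer_tree.snoc)

lemma is_tree_centralizer_tree: "is_tree (centralizer_tree G g)"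
proof -
  have "t \<in> centralizer_tree G g" if "s \<in> centralizer_tree G g" "prefix t s" for s t
    using that by (induction arbitrary: t rule: centralizer_tree.induct)
      (auto simp: prefix_snoc intro: centralizer_tree.intros)
  then show ?thesis by (auto simp: is_tree_def)
qed


section \<open>Marked groups\<close>

abbreviation marked_group :: "nat word set \<Rightarrow> nat word set monoid" where
  "marked_group N \<equiv> F_omega Mod N"

definition marking :: "(nat \<Rightarrow> nat word) \<Rightarrow> nat word set \<Rightarrow> nat \<Rightarrow> nat word set" where
  "marking \<gamma> N i = \<gamma> i <#\<^bsub>F_omega\<^esub> N"

end

theory Submission
  imports Defs
begin

text \<open>
  An infinite branch of the centralizer tree is the same thing as a sequence of group elements
  each of which strictly shrinks the centralizer of its predecessors, so a branch directly yields
  an infinite strictly decreasing chain of centralizers.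

  Conversely, the centralizers in a given decreasing chain \<open>C\<^sub>G(A\<^sub>0) > C\<^sub>G(A\<^sub>1) > \<dots>\<close> are in general
  not centralizers of finite sets, let alone of an increasing sequence of sets that grows by one
  element at a time. But one element of each \<open>A\<close> suffices to witness a strict inclusion: choose
  \<open>y\<^sub>n \<in> C\<^sub>G(A\<^sub>n)\<close> outside \<open>C\<^sub>G(A\<^sub>n\<^sub>+\<^sub>1)\<close> and then \<open>a\<^sub>n \<in> A\<^sub>n\<^sub>+\<^sub>1\<close> that does not commute with
  \<open>y\<^sub>n\<close>. For \<open>k < n\<close> the element \<open>a\<^sub>k\<close> lies in \<open>A\<^sub>k\<^sub>+\<^sub>1\<close>, which is centralized by
  \<open>C\<^sub>G(A\<^sub>n) \<subseteq> C\<^sub>G(A\<^sub>k\<^sub>+\<^sub>1)\<close>; hence \<open>y\<^sub>n\<close> commutes with \<open>a\<^sub>0, \<dots>, a\<^sub>n\<^sub>-\<^sub>1\<close> and not with \<open>a\<^sub>n\<close>.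
  Indices of the \<open>a\<^sub>n\<close> in the enumeration therefore form a branch.

  The argument works in any group with a surjective enumeration of its elements; the cosets
  \<open>\<gamma>\<^sub>i N\<close> are such an enumeration of \<open>F\<^sub>\<omega>/N\<close>.
\<close>

lemma centralizer_antimono: "A \<subseteq> B \<Longrightarrow> centralizer G B \<subseteq> centralizer G A"
  by (auto simp: centralizer_def)

lemma (in group) subgroup_centralizer:
  assumes "A \<subseteq> carrier G"
  shows "subgroup (centralizer G A) G"
proof (rule subgroupI)
  show "centralizer G A \<subseteq> carrier G"
    by (auto simp: centralizer_def)
  show "centralizer G A \<noteq> {}"
    using assms by (force simp: centralizer_def intro!: exI[of _ \<one>])
next
  fix x assume "x \<in> centralizer G A"
  then have x: "x \<in> carrier G" and comm: "\<And>a. a \<in> A \<Longrightarrow> x \<otimes> a = a \<otimes> x"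
    by (auto simp: centralizer_def)
  have "inv x \<otimes> a = a \<otimes> inv x" if "a \<in> A" for a
  proof -
    have a: "a \<in> carrier G" using that assms by blast
    have "inv x \<otimes> a = inv x \<otimes> (a \<otimes> x) \<otimes> inv x"
      using x a by (simp add: m_assoc)
    also have "\<dots> = a \<otimes> inv x"
      unfolding comm[OF that, symmetric] using x a by (simp add: m_assoc[symmetric])
    finally show ?thesis .
  qed
  then show "inv x \<in> centralizer G A"
    using x by (auto simp: centralizer_def)
next
  fix x y assume "x \<in> centralizer G A" "y \<in> centralizer G A"
  then have x: "x \<in> carrier G" and xc: "\<And>a. a \<in> A \<Longrightarrow> x \<otimes> a = a \<otimes> x"
    and y: "y \<in> carrier G" and yc: "\<And>a. a \<in> A \<Longrightarrow> y \<otimes> a = a \<otimes> y"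
    by (auto simp: centralizer_def)
  have "x \<otimes> y \<otimes> a = a \<otimes> (x \<otimes> y)" if "a \<in> A" for a
  proof -
    have a: "a \<in> carrier G" using that assms by blast
    have "x \<otimes> y \<otimes> a = x \<otimes> a \<otimes> y"
      using x y a by (simp add: m_assoc yc[OF that])
    also have "\<dots> = a \<otimes> (x \<otimes> y)"
      using x y a by (simp add: m_assoc xc[OF that])
    finally show ?thesis .
  qed
  then show "x \<otimes> y \<in> centralizer G A"
    using x y by (auto simp: centralizer_def)
qed

lemma (in group) is_centralizer_centralizer:
  "A \<subseteq> carrier G \<Longrightarrow> is_centralizer G (centralizer G A)"
  by (auto simp: is_centralizer_def subgroup_centralizer)

text \<open>
  The tree condition only asks consecutive centralizers to differ; since they are nested anyway,
  the branches are exactly the sequences along which the centralizers strictly decrease.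
\<close>

lemma centralizer_tree_branch_iff:
  "(\<forall>n. map x [0..<n] \<in> centralizer_tree G g) \<longleftrightarrow>
   (\<forall>n. centralizer G ((g \<circ> x) ` {..<Suc n}) \<subset> centralizer G ((g \<circ> x) ` {..<n}))"
  (is "?branch \<longleftrightarrow> (\<forall>n. ?step n)")
proof -
  have extend: "map x [0..<Suc n] \<in> centralizer_tree G g \<longleftrightarrow>
      map x [0..<n] \<in> centralizer_tree G g \<and> ?step n" for n
  proof -
    have init: "g ` set (map x [0..<n]) = (g \<circ> x) ` {..<n}"
      by (auto simp: image_comp lessThan_atLeast0)
    have last: "(g \<circ> x) ` {..<n} \<union> {g (x n)} = (g \<circ> x) ` {..<Suc n}"
      by (auto simp: lessThan_Suc)
    have "map x [0..<Suc n] \<in> centralizer_tree G g \<longleftrightarrow>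
        map x [0..<n] \<in> centralizer_tree G g \<and>
        centralizer G ((g \<circ> x) ` {..<Suc n}) \<noteq> centralizer G ((g \<circ> x) ` {..<n})"
      using snoc_in_centralizer_tree_iff[of "map x [0..<n]" "x n" G g]
      unfolding init last by simp
    moreover have "centralizer G ((g \<circ> x) ` {..<Suc n}) \<subseteq> centralizer G ((g \<circ> x) ` {..<n})"
      by (rule centralizer_antimono) auto
    ultimately show ?thesis by blast
  qed
  show ?thesis
  proof
    assume ?branch
    then show "\<forall>n. ?step n" using extend by blast
  next
    assume step: "\<forall>n. ?step n"
    have "map x [0..<n] \<in> centralizer_tree G g" for n
    proof (induction n)
      case 0
      show ?case by (simp add: centralizer_tree.Nil)
    next
      case (Suc n)
      then show ?case using extend step by blast
    qed
    then show ?branch ..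
  qed
qed

text \<open>
  One non-commuting pair per strict inclusion suffices: its element from the larger centralized
  set becomes the next term, and later terms of the chain still commute with it because the
  chain decreases. The sets \<open>a ` {..<n}\<close> then grow by one element at a time, which is the form
  that a branch of the tree requires.
\<close>

lemma decreasing_centralizers_sequence:
  assumes cent: "\<And>n. is_centralizer G (C n)"
    and decr: "\<And>n. C (Suc n) \<subset> C n"
  obtains a :: "nat \<Rightarrow> 'a"
  where "range a \<subseteq> carrier G"
    and "\<And>n. centralizer G (a ` {..<Suc n}) \<subset> centralizer G (a ` {..<n})"
proof -
  have "\<forall>n. \<exists>A. A \<subseteq> carrier G \<and> C n = centralizer G A"
    using cent by (simp add: is_centralizer_def)
  then obtain A where A: "\<And>n. A n \<subseteq> carrier G" "\<And>n. C n = centralizer G (A n)"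
    by metis
  have "\<exists>a y. a \<in> A (Suc n) \<and> y \<in> C n \<and> y \<otimes>\<^bsub>G\<^esub> a \<noteq> a \<otimes>\<^bsub>G\<^esub> y" for n
  proof -
    obtain y where "y \<in> C n" "y \<notin> C (Suc n)"
      using decr[of n] by blast
    moreover from this have "y \<in> carrier G"
      unfolding A(2) by (simp add: centralizer_def)
    ultimately show ?thesis
      unfolding A(2)[of "Suc n"] by (auto simp: centralizer_def)
  qed
  then obtain a y where a: "\<And>n. a n \<in> A (Suc n)" and y: "\<And>n. y n \<in> C n"
    and ncomm: "\<And>n. y n \<otimes>\<^bsub>G\<^esub> a n \<noteq> a n \<otimes>\<^bsub>G\<^esub> y n"
    by metis
  have "centralizer G (a ` {..<Suc n}) \<subset> centralizer G (a ` {..<n})" for n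
  proof -
    have "y n \<otimes>\<^bsub>G\<^esub> a k = a k \<otimes>\<^bsub>G\<^esub> y n" if "k < n" for k
    proof -
      have "C n \<subseteq> C (Suc k)"
        by (rule lift_Suc_antimono_le[of C, OF psubset_imp_subset[OF decr]]) (simp add: Suc_leI that)
      then have "y n \<in> centralizer G (A (Suc k))"
        using y[of n] unfolding A(2)[of "Suc k", symmetric] by blast
      then show ?thesis
        using a[of k] by (auto simp: centralizer_def)
    qed
    moreover have "y n \<in> carrier G"
      using y[of n] unfolding A(2) by (simp add: centralizer_def)
    ultimately have "y n \<in> centralizer G (a ` {..<n})"
      by (auto simp: centralizer_def)
    moreover have "y n \<notin> centralizer G (a ` {..<Suc n})"
      using ncomm[of n] by (auto simp: centralizer_def)
    moreover have "centralizer G (a ` {..<Suc n}) \<subseteq> centralizer G (a ` {..<n})"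
      by (rule centralizer_antimono) auto
    ultimately show ?thesis by blast
  qed
  moreover have "range a \<subseteq> carrier G"
    using a A(1) by blast
  ultimately show ?thesis
    using that by blast
qed

lemma (in group) well_founded_centralizer_tree_iff:
  assumes range: "range g = carrier G"
  shows "well_founded_tree (centralizer_tree G g) \<longleftrightarrow> min_condition_centralizers G"
proof -
  have "(\<exists>x. \<forall>n. map x [0..<n] \<in> centralizer_tree G g) \<longleftrightarrow>
      (\<exists>C. (\<forall>n. is_centralizer G (C n)) \<and> (\<forall>n. C (Suc n) \<subset> C (n::nat)))"
    (is "?branch \<longleftrightarrow> ?chain")
  proof
    assume ?branch
    then obtain x where
      x: "\<forall>n. centralizer G ((g \<circ> x) ` {..<Suc n}) \<subset> centralizer G ((g \<circ> x) ` {..<n})"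
      unfolding centralizer_tree_branch_iff by blast
    have "is_centralizer G (centralizer G ((g \<circ> x) ` {..<n}))" for n
      using range by (intro is_centralizer_centralizer) auto
    with x show ?chain
      by (intro exI[of _ "\<lambda>n. centralizer G ((g \<circ> x) ` {..<n})"]) blast
  next
    assume ?chain
    then obtain a where "range a \<subseteq> carrier G"
      and a: "\<And>n. centralizer G (a ` {..<Suc n}) \<subset> centralizer G (a ` {..<n})"
      by (metis decreasing_centralizers_sequence)
    then have "\<forall>n. \<exists>i. g i = a n"
      using range by (metis rangeE rangeI subsetD)
    then obtain x where "\<And>n. g (x n) = a n"
      by metis
    then have "a = g \<circ> x" by auto
    with a show ?branch
      unfolding centralizer_tree_branch_iff by blast
  qed
  then show ?thesis
    by (simp add: well_founded_tree_def min_condition_centralizers_def is_tree_centralizer_tree)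
qed

text \<open>
  The carrier of the quotient consists of right cosets and the marking of left cosets; normality
  identifies the two.
\<close>

lemma range_marking:
  assumes "range \<gamma> = carrier F_omega" and "N \<lhd> F_omega"
  shows "range (marking \<gamma> N) = carrier (marked_group N)"
proof -
  have "marking \<gamma> N i = N #>\<^bsub>F_omega\<^esub> \<gamma> i" for i
    using normal.coset_eq[OF assms(2)] assms(1) by (auto simp: marking_def)
  then have "range (marking \<gamma> N) = (\<lambda>w. N #>\<^bsub>F_omega\<^esub> w) ` range \<gamma>"
    by auto
  also have "\<dots> = carrier (marked_group N)"
    by (auto simp: assms(1) FactGroup_def RCOSETS_def)
  finally show ?thesis .
qed

theorem lemma3p4:
  fixes \<gamma> :: "nat \<Rightarrow> nat word" and N :: "nat word set"
  assumes "range \<gamma> = carrier F_omega"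
    and "N \<lhd> F_omega"
  shows "well_founded_tree (centralizer_tree (marked_group N) (marking \<gamma> N))
    \<longleftrightarrow> min_condition_centralizers (marked_group N)"
  using group.well_founded_centralizer_tree_iff[OF normal.factorgroup_is_group[OF assms(2)]
      range_marking[OF assms]] .

end
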